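(* The right action of the virtual braid group $VB_2=\langle \sigma_1,\rho_1 \mid \rho_1^2=1\rangle$ on the set $\mathbb{Z}^4$, in which $\sigma_1$, $\sigma_1^{-1}$ and $\rho_1$ act by the maps $\sigma$, $\sigma^{-1}$ and $\rho$ respectively (given by the explicit formulae in the context), is faithful; that is, if $\beta\in VB_2$ satisfies $v\cdot\beta=v$ for all $v\in\mathbb{Z}^4$, then $\beta$ is the identity element of $VB_2$.
   Context: The virtual braid group $VB_n$ ($n\geqslant 2$) is the group with generators $\sigma_1,\dots,\sigma_{n-1},\rho_1,\dots,\rho_{n-1}$ and defining relations: $\sigma_i\sigma_{i+1}\sigma_i=\sigma_{i+1}\sigma_i\sigma_{i+1}$; $\sigma_i\sigma_j=\sigma_j\sigma_i$ if $|i-j|>1$; $\rho_i^2=1$; $\rho_i\rho_{i+1}\rho_i=\rho_{i+1}\rho_i\rho_{i+1}$; $\rho_i\rho_j=\rho_j\rho_i$ if $|i-j|>1$; $\sigma_i\rho_j=\rho_j\sigma_i$ if $|i-j|>1$; $\rho_i\rho_{i+1}\sigma_i=\sigma_{i+1}\rho_i\rho_{i+1}$. For $n=2$ the generators are $\sigma_1,\rho_1$ and the only defining relation is $\rho_1^2=1$. For $x\in\mathbb{Z}$ write $x^+=\max\{0,x\}$ and $x^-=\min\{x,0\}$. Define maps $\sigma,\sigma^{-1},\rho:\mathbb{Z}^4\to\mathbb{Z}^4$ (written on the right) by $$(a,b,c,d)\cdot\sigma=\bigl(a+b^++(d^+-e)^+,\ d-e^+,\ c+d^-+(b^-+e)^-,\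 b+e^+\bigr),$$ $$(a,b,c,d)\cdot\sigma^{-1}=\bigl(a-b^+-(d^++f)^+,\ d+f^-,\ c-d^--(b^--f)^-,\ b-f^-\bigr),$$ $$(a,b,c,d)\cdot\rho=(c,d,a,b),$$ where $e=a-b^--c+d^+$ and $f=a+b^--c-d^+$. The maps $\sigma$ and $\sigma^{-1}$ are mutually inverse bijections and $\rho$ is an involution, so these maps define a right action of $VB_2$ on the set $\mathbb{Z}^4$ (by bijections, not necessarily linear): a word in $\sigma_1^{\pm1},\rho_1$ acts by applying the maps corresponding to its letters successively from left to right, i.e. $v\cdot(\sigma_1^{\varepsilon}w')=(v\cdot\sigma^{\varepsilon})\cdot w'$ for $\varepsilon=\pm1$ and $v\cdot(\rho_1w')=(v\cdot\rho)\cdot w'$, with the empty word acting as the identity. *)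

theory Defs
  imports "HOL-Algebra.Group"
begin

section \<open>Groups given by generators and relations\<close>

text \<open>
  A word is a list of letters; the letter \<open>(x, True)\<close> stands for the generator \<open>x\<close> and
  \<open>(x, False)\<close> for its formal inverse.
\<close>

type_synonym 'g word = "('g \<times> bool) list"

text \<open>
  Two words are equal in the group with generators the elements of \<open>'g\<close> and defining
  relations \<open>r = 1\<close> for \<open>r \<in> R\<close> iff one can be transformed into the other by finitely many
  insertions and deletions of subwords \<open>x x\<^sup>-\<^sup>1\<close>, \<open>x\<^sup>-\<^sup>1 x\<close> and relators.
\<close>

inductive word_eq :: "'g word set \<Rightarrow> 'g word \<Rightarrow> 'g word \<Rightarrow> bool" for R where
  refl: "word_eq R u u"
| sym: "word_eq R u v \<Longrightarrow> word_eq R v u"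
| trans: "word_eq R u v \<Longrightarrow> word_eq R v w \<Longrightarrow> word_eq R u w"
| cancel: "word_eq R (u @ [(x, b), (x, \<not> b)] @ v) (u @ v)"
| relator: "r \<in> R \<Longrightarrow> word_eq R (u @ r @ v) (u @ v)"

definition word_rel :: "'g word set \<Rightarrow> ('g word \<times> 'g word) set" where
  "word_rel R = {(u, v). word_eq R u v}"

definition presented_group :: "'g word set \<Rightarrow> 'g word set monoid" where
  "presented_group R =
    \<lparr>carrier = UNIV // word_rel R,
     monoid.mult = (\<lambda>A B. \<Union>u\<in>A. \<Union>v\<in>B. word_rel R `` {u @ v}),
     one = word_rel R `` {[]}\<rparr>"

lemma equiv_word_rel: "equiv UNIV (word_rel R)"
  by (rule equivI)
    (auto simp: word_rel_def refl_on_def sym_def trans_def intro: word_eq.intros)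

lemma word_eq_context: "word_eq R u v \<Longrightarrow> word_eq R (p @ u @ q) (p @ v @ q)"
proof (induction rule: word_eq.induct)
  case (cancel u x b v)
  show ?case using word_eq.cancel[of R "p @ u" x b "v @ q"] by simp
next
  case (relator r u v)
  then show ?case using word_eq.relator[of r R "p @ u" "v @ q"] by simp
qed (blast intro: word_eq.intros)+

lemma word_eq_append:
  assumes "word_eq R u u'" "word_eq R v v'"
  shows "word_eq R (u @ v) (u' @ v')"
  using word_eq_context[OF assms(1), of "[]" v] word_eq_context[OF assms(2), of u' "[]"]
  by (auto intro: word_eq.trans)

lemma word_class_eq_iff: "word_rel R `` {u} = word_rel R `` {v} \<longleftrightarrow> word_eq R u v"
  using eq_equiv_class_iff[OF equiv_word_rel, of u v R] by (simp add: word_rel_def)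

lemma presented_group_carrier:
  "A \<in> carrier (presented_group R) \<longleftrightarrow> (\<exists>u. A = word_rel R `` {u})"
  by (auto simp: presented_group_def quotient_def)

lemma presented_group_mult:
  "word_rel R `` {u} \<otimes>\<^bsub>presented_group R\<^esub> word_rel R `` {v} = word_rel R `` {u @ v}"
proof -
  have "word_rel R `` {u' @ v'} = word_rel R `` {u @ v}"
    if "u' \<in> word_rel R `` {u}" "v' \<in> word_rel R `` {v}" for u' v'
    unfolding word_class_eq_iff using that
    by (auto simp: word_rel_def intro: word_eq_append word_eq.sym)
  moreover have "u \<in> word_rel R `` {u}" "v \<in> word_rel R `` {v}"
    by (auto simp: word_rel_def intro: word_eq.refl)
  ultimately show ?thesis
    unfolding presented_group_def monoid.simps by blast
qed

lemma presented_group_one: "\<one>\<^bsub>presented_group R\<^esub> = word_rel R `` {[]}"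
  by (simp add: presented_group_def)

lemma word_eq_inverse: "\<exists>w. word_eq R (w @ u) []"
proof (induction u)
  case Nil
  show ?case by (rule exI[of _ "[]"]) (simp add: word_eq.refl)
next
  case (Cons l u)
  obtain x b where l: "l = (x, b)" by (cases l)
  from Cons obtain w where w: "word_eq R (w @ u) []" ..
  have "word_eq R ((w @ [(x, \<not> b)]) @ l # u) (w @ u)"
    using word_eq.cancel[of R w x "\<not> b" u] by (simp add: l)
  with w show ?case by (blast intro: word_eq.trans)
qed

lemma group_presented_group: "group (presented_group R)"
proof (rule groupI)
  fix A assume "A \<in> carrier (presented_group R)"
  then obtain u where A: "A = word_rel R `` {u}"
    by (auto simp: presented_group_carrier)
  obtain w where "word_eq R (w @ u) []"
    using word_eq_inverse by blast
  then have "word_rel R `` {w} \<otimes>\<^bsub>presented_group R\<^esub> A = \<one>\<^bsub>presented_group R\<^esub>"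
    unfolding A presented_group_mult presented_group_one word_class_eq_iff .
  moreover have "word_rel R `` {w} \<in> carrier (presented_group R)"
    unfolding presented_group_carrier by blast
  ultimately show "\<exists>B\<in>carrier (presented_group R). B \<otimes>\<^bsub>presented_group R\<^esub> A = \<one>\<^bsub>presented_group R\<^esub>" ..
qed (auto simp: presented_group_carrier presented_group_mult presented_group_one)


section \<open>The virtual braid group on two strands\<close>

datatype vb2_gen = Sigma1 | Rho1

definition VB2_relators :: "vb2_gen word set" where
  "VB2_relators = {[(Rho1, True), (Rho1, True)]}"

definition VB2 :: "vb2_gen word set monoid" where
  "VB2 = presented_group VB2_relators"

lemma group_VB2: "group VB2"
  unfolding VB2_def by (rule group_presented_group)


section \<open>The action on quadruples of integers\<close>

type_synonym int4 = "int \<times> int \<times> int \<times> int"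

definition pos_part :: "int \<Rightarrow> int" where "pos_part x = max 0 x"

text \<open>The negative part is the nonpositive number \<open>min x 0\<close>, not its absolute value.\<close>

definition neg_part :: "int \<Rightarrow> int" where "neg_part x = min x 0"

fun sigma_map :: "int4 \<Rightarrow> int4" where
  "sigma_map (a, b, c, d) =
    (let e = a - neg_part b - c + pos_part d in
      (a + pos_part b + pos_part (pos_part d - e),
       d - pos_part e,
       c + neg_part d + neg_part (neg_part b + e),
       b + pos_part e))"

fun sigma_inv_map :: "int4 \<Rightarrow> int4" where
  "sigma_inv_map (a, b, c, d) =
    (let f = a + neg_part b - c - pos_part d in
      (a - pos_part b - pos_part (pos_part d + f),
       d + neg_part f,
       c - neg_part d - neg_part (neg_part b - f),
       b - neg_part f))"

fun rho_map :: "int4 \<Rightarrow> int4" where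
  "rho_map (a, b, c, d) = (c, d, a, b)"

text \<open>The formal inverse of \<open>Rho1\<close> acts by \<open>rho_map\<close> as well, since that map is an involution.\<close>

fun letter_act :: "int4 \<Rightarrow> vb2_gen \<times> bool \<Rightarrow> int4" where
  "letter_act v (Sigma1, True) = sigma_map v"
| "letter_act v (Sigma1, False) = sigma_inv_map v"
| "letter_act v (Rho1, _) = rho_map v"

fun word_act :: "int4 \<Rightarrow> vb2_gen word \<Rightarrow> int4" where
  "word_act v [] = v"
| "word_act v (l # w) = word_act (letter_act v l) w"

text \<open>
  An element of \<open>VB2\<close> is a class of words; it acts by the common action of these words
  (see \<open>VB2_act_class\<close> for well-definedness).
\<close>

definition VB2_act :: "int4 \<Rightarrow> vb2_gen word set \<Rightarrow> int4" where
  "VB2_act v \<beta> = the_elem (word_act v ` \<beta>)"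

lemma part_simps:
  "0 \<le> x \<Longrightarrow> pos_part x = x" "x \<le> 0 \<Longrightarrow> pos_part x = 0"
  "0 \<le> x \<Longrightarrow> neg_part x = 0" "x \<le> 0 \<Longrightarrow> neg_part x = x"
  by (simp_all add: pos_part_def neg_part_def)


lemma sigma_inv_sigma: "sigma_inv_map (sigma_map v) = v"
proof (cases v)
  case (fields a b c d)
  define e where "e = a - neg_part b - c + pos_part d"
  then have a: "a = e + neg_part b + c - pos_part d" by simp
  show ?thesis
    unfolding fields a
    by (cases "0 \<le> b"; cases "0 \<le> d"; cases "0 \<le> e"; cases "d \<le> e"; cases "0 \<le> b + e";
        simp add: Let_def part_simps)
qed

lemma sigma_sigma_inv: "sigma_map (sigma_inv_map v) = v"
proof (cases v)
  case (fields a b c d)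
  define f where "f = a + neg_part b - c - pos_part d"
  then have a: "a = f - neg_part b + c + pos_part d" by simp
  show ?thesis
    unfolding fields a
    by (cases "0 \<le> b"; cases "0 \<le> d"; cases "0 \<le> f"; cases "0 \<le> d + f"; cases "b \<le> f";
        simp add: Let_def part_simps)
qed
lemma rho_rho: "rho_map (rho_map v) = v"
  by (cases v) simp

lemma word_act_append: "word_act v (u @ w) = word_act (word_act v u) w"
  by (induction u arbitrary: v) auto

lemma letter_act_cancel: "letter_act (letter_act v (x, b)) (x, \<not> b) = v"
  by (cases x; cases b) (simp_all add: sigma_inv_sigma sigma_sigma_inv rho_rho)

lemma word_act_cong: "word_eq VB2_relators u w \<Longrightarrow> word_act v u = word_act v w"
  by (induction arbitrary: v rule: word_eq.induct)
    (auto simp: word_act_append letter_act_cancel VB2_relators_def rho_rho)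

lemma VB2_act_class: "VB2_act v (word_rel VB2_relators `` {w}) = word_act v w"
proof -
  have "word_act v ` (word_rel VB2_relators `` {w}) = {word_act v w}"
    by (auto simp: word_rel_def intro: word_eq.refl dest: word_act_cong[where v = v])
  then show ?thesis by (simp add: VB2_act_def)
qed

lemma VB2_act_one: "VB2_act v \<one>\<^bsub>VB2\<^esub> = v"
  by (simp add: VB2_def presented_group_one VB2_act_class)

lemma VB2_act_mult:
  assumes "\<alpha> \<in> carrier VB2" "\<beta> \<in> carrier VB2"
  shows "VB2_act v (\<alpha> \<otimes>\<^bsub>VB2\<^esub> \<beta>) = VB2_act (VB2_act v \<alpha>) \<beta>"
  using assms
  by (auto simp: VB2_def presented_group_carrier presented_group_mult VB2_act_class word_act_append)

end

theory Submission
  imports Defs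
begin

text \<open>
  The group is the free product of the infinite cyclic group generated by \<open>\<sigma>\<close> and the group of
  order two generated by \<open>\<rho>\<close>, and faithfulness is a ping-pong argument.

  Both maps depend on \<open>a\<close> and \<open>c\<close> only through \<open>x = a - c\<close>, up to a common translation of \<open>a\<close>
  and \<open>c\<close>, and both preserve \<open>b + d\<close>. On the slice \<open>b + d = 0\<close> this leaves a piecewise linear
  action on the plane with coordinates \<open>(x, b)\<close>, where \<open>\<rho>\<close> is the antipodal map and \<open>\<sigma>\<close> acts on
  rays like a parabolic map, whose only fixed ray is \<open>x = 0\<close>, \<open>b < 0\<close>. One application of \<open>\<sigma>\<close>
  carries the ray \<open>x < 0\<close>, \<open>b = 0\<close> to the opposite ray, so the half-plane \<open>b > 0\<close> spans exactly
  one fundamental domain. Hence \<open>\<sigma>\<close> sends it into the quadrant \<open>b < 0 < x\<close>, where all further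
  powers of \<open>\<sigma>\<close> remain, and \<open>\<sigma>\<^sup>-\<^sup>1\<close> sends it into the quadrant \<open>x, b < 0\<close>, where all further
  powers of \<open>\<sigma>\<^sup>-\<^sup>1\<close> remain; \<open>\<rho>\<close> brings both quadrants back to the half-plane \<open>b > 0\<close>
  (\<open>sector_step\<close>).

  A point on the axis \<open>x = 0\<close> is therefore moved off the axis by the first power of \<open>\<sigma>\<close> in a
  reduced word, if it lies on the correct side, and it never comes back. Since every word is
  equal in the group to a reduced one (\<open>reduced_representative\<close>), only the empty reduced word acts
  trivially.
\<close>

text \<open>
  Two adjacent letters \<open>\<rho>\<^sup>\<plusminus>\<^sup>1\<close> cancel whatever their signs, so that \<open>\<rho>\<close> and its formal inverse
  need not be identified before words are reduced.
\<close>

definition cancels :: "vb2_gen \<times> bool \<Rightarrow> vb2_gen \<times> bool \<Rightarrow> bool" where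
  "cancels l m \<longleftrightarrow> fst l = fst m \<and> (fst l = Rho1 \<or> snd l \<noteq> snd m)"

abbreviation reduced :: "vb2_gen word \<Rightarrow> bool" where
  "reduced \<equiv> successively (\<lambda>l m. \<not> cancels l m)"

lemma word_eq_cancels:
  assumes "cancels l m"
  shows "word_eq VB2_relators (l # m # w) w"
proof -
  have inv: "word_eq VB2_relators ((x, b) # (x, \<not> b) # u) u" for x b u
    using word_eq.cancel[of VB2_relators "[]" x b u] by simp
  have rel: "word_eq VB2_relators (u @ (Rho1, True) # (Rho1, True) # v) (u @ v)" for u v
    using word_eq.relator[of "[(Rho1, True), (Rho1, True)]" VB2_relators u v]
    by (simp add: VB2_relators_def)
  \<comment> \<open>The square of the formal inverse of \<open>\<rho>\<close> is no relator: insert \<open>\<rho>\<^sup>2\<close> behind it and cancel twice.\<close>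
  have "word_eq VB2_relators ((Rho1, False) # (Rho1, False) # w)
      ((Rho1, False) # (Rho1, False) # (Rho1, True) # (Rho1, True) # w)"
    using rel[of "[(Rho1, False), (Rho1, False)]" w] by (auto intro: word_eq.sym)
  also have "word_eq VB2_relators \<dots> ((Rho1, False) # (Rho1, True) # w)"
    using word_eq.cancel[of VB2_relators "[(Rho1, False)]" Rho1 False "(Rho1, True) # w"] by simp
  also (word_eq.trans) have "word_eq VB2_relators \<dots> w"
    using inv[of Rho1 False w] by simp
  finally (word_eq.trans) have rho_inv:
    "word_eq VB2_relators ((Rho1, False) # (Rho1, False) # w) w" .
  obtain x b c where l: "l = (x, b)" and m: "m = (x, c)"
    using assms by (cases l; cases m) (auto simp: cancels_def)
  show ?thesis
  proof (cases "b = c")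
    case False
    then show ?thesis using inv[of x b w] by (simp add: l m)
  next
    case True
    with assms have "x = Rho1" by (simp add: cancels_def l m)
    with True rho_inv rel[of "[]" w] show ?thesis by (cases b) (simp_all add: l m)
  qed
qed

lemma reduced_representative: "\<exists>u. word_eq VB2_relators w u \<and> reduced u"
proof (induction w)
  case Nil
  show ?case by (rule exI[of _ "[]"]) (simp add: word_eq.refl)
next
  case (Cons l w)
  then obtain u where u: "word_eq VB2_relators w u" "reduced u" by blast
  have eq: "word_eq VB2_relators (l # w) (l # u)"
    using word_eq_context[OF u(1), of "[l]" "[]"] by simp
  show ?case
  proof (cases "\<exists>m u'. u = m # u' \<and> cancels l m")
    case True
    then obtain m u' where m: "u = m # u'" "cancels l m" by blast
    have "word_eq VB2_relators (l # w) u'"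
      using eq word_eq_cancels[OF m(2)] unfolding m(1) by (rule word_eq.trans)
    moreover have "reduced u'" using u(2) by (auto simp: m(1) successively_Cons)
    ultimately show ?thesis by blast
  next
    case False
    then have "reduced (l # u)" using u(2) by (cases u) (auto simp: successively_Cons)
    with eq show ?thesis by blast
  qed
qed

text \<open>
  The ping-pong region in which a reduced word ending with the given letter lands. The
  axis \<open>a = c\<close> is left out of every region, because the starting points are taken from it; after
  \<open>\<rho>\<close> the sign of \<open>a - c\<close> is arbitrary, as it depends on the preceding power of \<open>\<sigma>\<close>.
\<close>

fun sector :: "vb2_gen \<times> bool \<Rightarrow> int4 set" where
  "sector (Sigma1, True) = {(a, b, c, d). d = - b \<and> b < 0 \<and> c < a}"
| "sector (Sigma1, False) = {(a, b, c, d). d = - b \<and> b < 0 \<and> a < c}"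
| "sector (Rho1, _) = {(a, b, c, d). d = - b \<and> 0 < b \<and> a \<noteq> c}"

lemma sector_off_axis: "(a, b, a, d) \<notin> sector l"
  by (cases l rule: sector.cases) auto

text \<open>
  In the coordinates \<open>x = a - c\<close> and \<open>b > 0\<close>, the map \<open>\<sigma>\<close> is \<open>(x, b) \<mapsto> (\<bar>x\<bar> + 2 b, - b - x\<^sup>+)\<close>
  and \<open>\<sigma>\<^sup>-\<^sup>1\<close> is \<open>(x, b) \<mapsto> (- \<bar>x\<bar> - 2 b, - b + x\<^sup>-)\<close>.
\<close>

lemma sigma_of_upper_half_plane:
  assumes "0 < b"
  shows "letter_act (a, b, c, - b) (Sigma1, s) \<in> sector (Sigma1, s)"
  using assms by (cases s) (auto simp: Let_def pos_part_def neg_part_def)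

text \<open>
  On the quadrants that the powers of \<open>\<sigma>\<close> with a fixed sign do not leave, \<open>\<sigma>\<close> and \<open>\<sigma>\<^sup>-\<^sup>1\<close> act by
  the shears \<open>(x, b) \<mapsto> (x, b - x)\<close> and \<open>(x, b) \<mapsto> (x, b + x)\<close>.
\<close>

lemma sector_step:
  assumes "v \<in> sector l" "\<not> cancels l m"
  shows "letter_act v m \<in> sector m"
proof -
  obtain a b c d where v: "v = (a, b, c, d)" by (cases v)
  obtain x s where m: "m = (x, s)" by (cases m)
  have d: "d = - b" using assms(1) by (cases l rule: sector.cases) (auto simp: v)
  show ?thesis
  proof (cases x)
    case Rho1
    then show ?thesis using assms by (cases l rule: sector.cases) (auto simp: v m cancels_def)
  next
    case Sigma1
    show ?thesis
    proof (cases "0 < b")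
      case True
      then show ?thesis using sigma_of_upper_half_plane by (simp add: v d m Sigma1)
    next
      case False
      \<comment> \<open>Then \<open>l\<close> is no \<open>\<rho>\<close>, and as it does not cancel against \<open>m\<close> it is the same letter \<open>\<sigma>\<^sup>\<plusminus>\<^sup>1\<close>.\<close>
      with assms have "l = m"
        by (cases l rule: sector.cases) (auto simp: v m Sigma1 cancels_def)
      with assms(1) show ?thesis
        by (cases s) (auto simp: v m Sigma1 Let_def pos_part_def neg_part_def)
    qed
  qed
qed

lemma word_act_in_sector:
  assumes "v \<in> sector l" "reduced (l # w)"
  shows "word_act v w \<in> sector (last (l # w))"
  using assms
proof (induction w arbitrary: v l)
  case (Cons m w)
  from Cons.prems have "letter_act v m \<in> sector m" by (auto intro: sector_step)
  from Cons.IH[OF this] Cons.prems show ?case by simp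
qed simp

lemma reduced_word_from_sigma_leaves_axis:
  assumes "reduced ((Sigma1, s) # w)"
  shows "word_act (0, 1, 0, - 1) ((Sigma1, s) # w) \<noteq> (0, b, 0, d)"
proof -
  have "letter_act (0, 1, 0, - 1) (Sigma1, s) \<in> sector (Sigma1, s)"
    by (rule sigma_of_upper_half_plane) simp
  from word_act_in_sector[OF this assms] show ?thesis
    by (auto simp del: letter_act.simps simp: sector_off_axis)
qed

text \<open>
  A leading \<open>\<rho>\<close> is accounted for by starting at the antipodal point of the axis, so that the
  first power of \<open>\<sigma>\<close> still meets a point with \<open>b > 0\<close>.
\<close>

lemma reduced_word_acts_nontrivially:
  assumes "reduced w" "w \<noteq> []"
  shows "\<exists>v. word_act v w \<noteq> v"
proof -
  obtain x s w' where w: "w = (x, s) # w'" using assms(2) by (cases w) auto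
  show ?thesis
  proof (cases x)
    case Sigma1
    then show ?thesis using reduced_word_from_sigma_leaves_axis assms(1) w by blast
  next
    case Rho1
    have "word_act (0, - 1, 0, 1) w = word_act (0, 1, 0, - 1) w'" by (simp add: w Rho1)
    also have "\<dots> \<noteq> (0, - 1, 0, 1)"
    proof (cases w')
      case Nil
      then show ?thesis by simp
    next
      case (Cons m w'')
      with assms(1) obtain t where "m = (Sigma1, t)"
        by (cases m; cases "fst m") (auto simp: w Rho1 cancels_def)
      then show ?thesis
        using reduced_word_from_sigma_leaves_axis assms(1) unfolding w Cons by fastforce
    qed
    finally show ?thesis by blast
  qed
qed

theorem theorem4p4:
  fixes \<beta> :: "vb2_gen word set"
  assumes "\<beta> \<in> carrier VB2"
    and "\<And>v :: int4. VB2_act v \<beta> = v"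
  shows "\<beta> = \<one>\<^bsub>VB2\<^esub>"
proof -
  obtain w where "\<beta> = word_rel VB2_relators `` {w}"
    using assms(1) by (auto simp: VB2_def presented_group_carrier)
  moreover obtain u where "word_eq VB2_relators w u" and u: "reduced u"
    using reduced_representative by blast
  ultimately have \<beta>: "\<beta> = word_rel VB2_relators `` {u}"
    by (simp add: word_class_eq_iff)
  have "word_act v u = v" for v
    using assms(2)[of v] by (simp add: \<beta> VB2_act_class)
  with u have "u = []" using reduced_word_acts_nontrivially by blast
  then show ?thesis by (simp add: \<beta> VB2_def presented_group_one)
qed

end
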